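(* Let $G$ be a finite simple connected graph of order $n$ with clique number $\omega$. Then \[\sqrt{s^+(G)} \le n\sqrt{1-\frac{1}{\omega}-\frac{1}{\omega^2}}\,.\]
   Context: For a graph $G$ with adjacency eigenvalues $\lambda_1\ge\cdots\ge\lambda_n$, the positive square energy is $s^+(G)=\sum_{\lambda_i>0}\lambda_i^2$.
   Formalization: The formal statement assumes n ≥ 2; for the one-vertex graph (ω = 1) the radicand 1 − 1/ω − 1/ω² equals −1, so the right-hand side is undefined, and no other connected graph is excluded. *)

theory Defs
  imports
    "Graph_Theory.Digraph_Component"
    "Jordan_Normal_Form.Char_Poly"
    "HOL-Library.Multiset"
begin

text \<open>Finite simple graphs are those of \<^locale>\<open>pair_graph\<close>: finite, loop-free, and with a
  symmetric set of arcs, an edge \<open>uv\<close> being the two arcs \<open>(u, v)\<close> and \<open>(v, u)\<close>.\<close>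

definition adjacency_matrix :: "'a pair_pre_digraph \<Rightarrow> 'a list \<Rightarrow> real mat" where
  "adjacency_matrix G vs =
     mat (length vs) (length vs) (\<lambda>(i, j). if (vs ! i, vs ! j) \<in> parcs G then 1 else 0)"

text \<open>The eigenvalues counted with multiplicity. The choice of the vertex enumeration is
  immaterial, see \<open>adjacency_eigenvalues_eq\<close> below. As the matrix is real and symmetric, the
  real roots of its characteristic polynomial are all the roots.\<close>

definition adjacency_eigenvalues :: "'a pair_pre_digraph \<Rightarrow> real multiset" where
  "adjacency_eigenvalues G =
     proots (char_poly (adjacency_matrix G (SOME vs. distinct vs \<and> set vs = pverts G)))"

definition positive_square_energy :: "'a pair_pre_digraph \<Rightarrow> real" where
  "positive_square_energy G = (\<Sum>x\<in>#filter_mset (\<lambda>x. x > 0) (adjacency_eigenvalues G). x\<^sup>2)"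

definition is_clique :: "'a pair_pre_digraph \<Rightarrow> 'a set \<Rightarrow> bool" where
  "is_clique G C \<longleftrightarrow> C \<subseteq> pverts G \<and> (\<forall>u\<in>C. \<forall>v\<in>C. u \<noteq> v \<longrightarrow> (u, v) \<in> parcs G)"

definition clique_number :: "'a pair_pre_digraph \<Rightarrow> nat" where
  "clique_number G = Max (card ` {C. is_clique G C})"

lemma similar_adjacency_matrix:
  assumes vs: "distinct vs" "set vs = V" and ws: "distinct ws" "set ws = V"
  shows "similar_mat (adjacency_matrix G vs) (adjacency_matrix G ws)"
proof -
  let ?n = "length vs"
  have len: "length ws = ?n"
    using vs ws distinct_card by metis
  define P :: "real mat" where "P = mat ?n ?n (\<lambda>(i, k). if vs ! i = ws ! k then 1 else 0)"
  define Q :: "real mat" where "Q = mat ?n ?n (\<lambda>(k, i). if vs ! i = ws ! k then 1 else 0)"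
  have ex_w: "\<exists>k<?n. ws ! k = vs ! i" if "i < ?n" for i
    using that vs ws len by (metis in_set_conv_nth nth_mem)
  have ex_v: "\<exists>i<?n. vs ! i = ws ! k" if "k < ?n" for k
    using that vs ws len by (metis in_set_conv_nth nth_mem)
  have inj_w: "ws ! k = ws ! l \<longleftrightarrow> k = l" if "k < ?n" "l < ?n" for k l
    using that ws len by (simp add: nth_eq_iff_index_eq)
  have inj_v: "vs ! k = vs ! l \<longleftrightarrow> k = l" if "k < ?n" "l < ?n" for k l
    using that vs by (simp add: nth_eq_iff_index_eq)
  have sum_w: "(\<Sum>k = 0..<?n. (if x = ws ! k then 1 else 0) * f k) = f l"
    if "l < ?n" "x = ws ! l" for x l and f :: "nat \<Rightarrow> real"
  proof -
    have "(\<Sum>k = 0..<?n. (if x = ws ! k then 1 else 0) * f k)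
        = (\<Sum>k = 0..<?n. if k = l then f k else 0)"
      using that inj_w by (intro sum.cong) auto
    then show ?thesis using that by simp
  qed
  have sum_v: "(\<Sum>k = 0..<?n. (if vs ! k = x then 1 else 0) * f k) = f l"
    if "l < ?n" "x = vs ! l" for x l and f :: "nat \<Rightarrow> real"
  proof -
    have "(\<Sum>k = 0..<?n. (if vs ! k = x then 1 else 0) * f k)
        = (\<Sum>k = 0..<?n. if k = l then f k else 0)"
      using that inj_v by (intro sum.cong) auto
    then show ?thesis using that by simp
  qed
  have dims: "P \<in> carrier_mat ?n ?n" "Q \<in> carrier_mat ?n ?n"
    "adjacency_matrix G vs \<in> carrier_mat ?n ?n" "adjacency_matrix G ws \<in> carrier_mat ?n ?n"
    by (auto simp: P_def Q_def adjacency_matrix_def len)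
  have PQ: "P * Q = 1\<^sub>m ?n"
  proof (rule eq_matI)
    fix i j assume "i < dim_row (1\<^sub>m ?n :: real mat)" "j < dim_col (1\<^sub>m ?n :: real mat)"
    then have ij: "i < ?n" "j < ?n" by auto
    obtain l where l: "l < ?n" "vs ! i = ws ! l" using ex_w[OF ij(1)] by metis
    show "(P * Q) $$ (i, j) = 1\<^sub>m ?n $$ (i, j)"
      using ij sum_w[OF l, of "\<lambda>k. if vs ! j = ws ! k then 1 else 0"] l inj_v[OF ij]
      by (auto simp: P_def Q_def scalar_prod_def)
  qed (auto simp: P_def Q_def)
  have QP: "Q * P = 1\<^sub>m ?n"
  proof (rule eq_matI)
    fix i j assume "i < dim_row (1\<^sub>m ?n :: real mat)" "j < dim_col (1\<^sub>m ?n :: real mat)"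
    then have ij: "i < ?n" "j < ?n" by auto
    obtain l where l: "l < ?n" "ws ! i = vs ! l" using ex_v[OF ij(1)] by metis
    show "(Q * P) $$ (i, j) = 1\<^sub>m ?n $$ (i, j)"
      using ij sum_v[OF l, of "\<lambda>k. if vs ! k = ws ! j then 1 else 0"] l inj_w[OF ij]
      by (auto simp: P_def Q_def scalar_prod_def)
  qed (auto simp: P_def Q_def)
  have AP: "adjacency_matrix G vs * P = P * adjacency_matrix G ws"
  proof (rule eq_matI)
    fix i j
    assume "i < dim_row (P * adjacency_matrix G ws)" "j < dim_col (P * adjacency_matrix G ws)"
    then have ij: "i < ?n" "j < ?n" using dims by auto
    obtain l where l: "l < ?n" "vs ! i = ws ! l" using ex_w[OF ij(1)] by metis
    obtain m where m: "m < ?n" "ws ! j = vs ! m" using ex_v[OF ij(2)] by metis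
    have "(adjacency_matrix G vs * P) $$ (i, j) = (if (vs ! i, vs ! m) \<in> parcs G then 1 else 0)"
      using ij sum_v[OF m, of "\<lambda>k. if (vs ! i, vs ! k) \<in> parcs G then 1 else 0"]
      by (simp add: P_def adjacency_matrix_def scalar_prod_def mult.commute)
    moreover have "(P * adjacency_matrix G ws) $$ (i, j)
        = (if (ws ! l, ws ! j) \<in> parcs G then 1 else 0)"
      using ij sum_w[OF l, of "\<lambda>k. if (ws ! k, ws ! j) \<in> parcs G then 1 else 0"]
      by (simp add: P_def adjacency_matrix_def scalar_prod_def len)
    ultimately show "(adjacency_matrix G vs * P) $$ (i, j) = (P * adjacency_matrix G ws) $$ (i, j)"
      using l m by simp
  qed (use dims in auto)
  have "adjacency_matrix G vs = adjacency_matrix G vs * (P * Q)"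
    using PQ dims by simp
  also have "\<dots> = adjacency_matrix G vs * P * Q"
    using dims by (simp add: assoc_mult_mat[of _ ?n ?n _ ?n _ ?n])
  also have "\<dots> = P * adjacency_matrix G ws * Q"
    by (simp add: AP)
  finally show ?thesis
    using dims PQ QP by (intro similar_matI[where n = ?n and P = P and Q = Q]) auto
qed

lemma adjacency_eigenvalues_eq:
  assumes "distinct vs" "set vs = pverts G"
  shows "adjacency_eigenvalues G = proots (char_poly (adjacency_matrix G vs))"
proof -
  let ?ws = "SOME vs. distinct vs \<and> set vs = pverts G"
  have "distinct ?ws \<and> set ?ws = pverts G"
    using assms by (intro someI_ex[of "\<lambda>vs. distinct vs \<and> set vs = pverts G"]) blast
  then have "similar_mat (adjacency_matrix G ?ws) (adjacency_matrix G vs)"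
    using assms by (intro similar_adjacency_matrix) auto
  then show ?thesis
    unfolding adjacency_eigenvalues_def by (metis char_poly_similar)
qed

end

theory Submission
  imports Defs "Jordan_Normal_Form.Spectral_Radius"
begin

text \<open>Let \<open>\<rho>\<close> be the largest eigenvalue of the adjacency matrix \<open>A\<close>, let \<open>s\<^sup>-\<close> be the sum of the squares
  of the negative eigenvalues, and let \<open>2m = tr A\<^sup>2\<close> be the sum of the degrees, so that
  \<open>s\<^sup>+ = 2m - s\<^sup>-\<close>. As \<open>A\<close> has nonnegative entries, every eigenvalue is at most \<open>\<rho>\<close> in absolute value.
  Comparing the cubes of the eigenvalues therefore gives \<open>\<rho> s\<^sup>- \<ge> \<rho>\<^sup>3 - tr A\<^sup>3\<close>. Neighbourhoods contain
  no clique on \<open>\<omega>\<close> vertices, so Turan's theorem inside each neighbourhood bounds \<open>tr A\<^sup>3\<close> by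
  \<open>(1 - 1/(\<omega> - 1)) \<Sum>d(v)\<^sup>2 \<le> (1 - 1/(\<omega> - 1)) \<rho>\<^sup>2 n\<close>. Hence
  \<open>s\<^sup>+ \<le> 2m - \<rho>\<^sup>2 + (1 - 1/(\<omega> - 1)) \<rho> n\<close>, and inserting \<open>2m \<le> \<rho> n\<close> or Turan's bound
  \<open>2m \<le> (1 - 1/\<omega>) n\<^sup>2\<close>, according to whether \<open>\<rho> \<le> (1 - 1/\<omega>) n\<close>, finishes the proof.\<close>

section \<open>Orthogonal diagonalization of real symmetric matrices\<close>

lemma hermitian_mat_eigenvalue_conjugate:
  fixes A :: "'a :: conjugatable_ordered_field mat"
  assumes A: "A \<in> carrier_mat n n" and hermitian: "A\<^sup>T = map_mat conjugate A"
    and "eigenvalue A e"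
  shows "conjugate e = e"
proof -
  obtain v where v: "v \<in> carrier_vec n" "v \<noteq> 0\<^sub>v n" and Av: "A *\<^sub>v v = e \<cdot>\<^sub>v v"
    using assms by (auto simp: eigenvalue_def eigenvector_def)
  have conj_v: "conjugate v \<in> carrier_vec n" using v(1) by simp
  have "A\<^sup>T *\<^sub>v conjugate v = conjugate (A *\<^sub>v v)"
    using A v(1) unfolding hermitian
    by (intro eq_vecI) (auto simp: scalar_prod_def sum_conjugate conjugate_dist_mul)
  also have "\<dots> = conjugate e \<cdot>\<^sub>v conjugate v"
    by (simp add: Av conjugate_smult_vec)
  finally have adjoint: "A\<^sup>T *\<^sub>v conjugate v = conjugate e \<cdot>\<^sub>v conjugate v" .
  have "conjugate e * (conjugate v \<bullet> v) = (A\<^sup>T *\<^sub>v conjugate v) \<bullet> v"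
    using conj_v v(1) by (simp add: adjoint)
  also have "\<dots> = conjugate v \<bullet> (A *\<^sub>v v)"
    using A v(1) conj_v by (rule transpose_vec_mult_scalar)
  also have "\<dots> = e * (conjugate v \<bullet> v)"
    using conj_v v(1) by (simp add: Av)
  finally have "conjugate e * (v \<bullet>c v) = e * (v \<bullet>c v)"
    using conjugate_vec_sprod_comm[OF v(1) v(1)] by simp
  then show ?thesis using v by simp
qed

lemma symmetric_mat_has_eigenvalue:
  fixes A :: "real mat"
  assumes A: "A \<in> carrier_mat n n" and sym: "A\<^sup>T = A" and "n > 0"
  obtains e where "eigenvalue A e"
proof -
  let ?C = "map_mat complex_of_real A"
  have C: "?C \<in> carrier_mat n n" using A by simp
  obtain z where z: "eigenvalue ?C z"
    using spectrum_non_empty[OF C \<open>n > 0\<close>] by (auto simp: spectrum_def)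
  have "?C\<^sup>T = map_mat conjugate ?C"
    by (subst (2) sym[symmetric]) auto
  from hermitian_mat_eigenvalue_conjugate[OF C this z] have "cnj z = z" by simp
  then have "z = of_real (Re z)" by (metis Reals_cnj_iff of_real_Re)
  then have "poly (map_poly of_real (char_poly A)) (of_real (Re z) :: complex) = 0"
    using z eigenvalue_root_char_poly[OF C] of_real_hom.char_poly_hom[OF A] by metis
  then have "eigenvalue A (Re z)"
    unfolding eigenvalue_root_char_poly[OF A] by simp
  then show thesis by (rule that)
qed

lemma mult_mat_unit_vec:
  fixes A :: "'a :: semiring_1 mat"
  assumes "A \<in> carrier_mat m n" "j < n"
  shows "A *\<^sub>v unit_vec n j = col A j"
  using col_mult2[OF assms(1) one_carrier_mat assms(2)] assms(2)
  by (simp add: right_mult_one_mat[OF assms(1)])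

text \<open>For \<open>w = 0\<close> the quotient is \<open>0\<close>, so that the reflection is the identity.\<close>

definition householder_mat :: "'a :: field vec \<Rightarrow> 'a mat" where
  "householder_mat w = mat (dim_vec w) (dim_vec w)
     (\<lambda>(i, j). of_bool (i = j) - 2 * w $ i * w $ j / (w \<bullet> w))"

lemma householder_mat_carrier: "w \<in> carrier_vec n \<Longrightarrow> householder_mat w \<in> carrier_mat n n"
  by (auto simp: householder_mat_def)

lemma transpose_householder_mat: "(householder_mat w)\<^sup>T = householder_mat w"
  by (intro eq_matI) (auto simp: householder_mat_def)

lemma householder_mat_mult_vec:
  assumes w: "w \<in> carrier_vec n" and x: "x \<in> carrier_vec n"
  shows "householder_mat w *\<^sub>v x = x - (2 * (w \<bullet> x) / (w \<bullet> w)) \<cdot>\<^sub>v w"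
proof (rule eq_vecI)
  fix i assume "i < dim_vec (x - (2 * (w \<bullet> x) / (w \<bullet> w)) \<cdot>\<^sub>v w)"
  then have i: "i < n" using w by simp
  define c where "c = 2 * w $ i / (w \<bullet> w)"
  have "(householder_mat w *\<^sub>v x) $ i = (\<Sum>j = 0..<n. (of_bool (i = j) - c * w $ j) * x $ j)"
    using w x i by (simp add: householder_mat_def scalar_prod_def c_def)
  also have "\<dots> = (\<Sum>j = 0..<n. of_bool (i = j) * x $ j) - c * (w \<bullet> x)"
    using x by (simp add: left_diff_distrib sum_subtractf scalar_prod_def sum_distrib_left mult.assoc)
  also have "(\<Sum>j = 0..<n. of_bool (i = j) * x $ j) = x $ i"
    using i by (simp add: of_bool_def if_distrib[of "\<lambda>a. a * _"] cong: if_cong)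
  finally show "(householder_mat w *\<^sub>v x) $ i = (x - (2 * (w \<bullet> x) / (w \<bullet> w)) \<cdot>\<^sub>v w) $ i"
    using w x i by (simp add: c_def mult.commute)
qed (use w x in \<open>simp add: householder_mat_def\<close>)

lemma householder_mat_involution:
  assumes w: "w \<in> carrier_vec n"
  shows "householder_mat w * householder_mat w = 1\<^sub>m n"
proof -
  let ?H = "householder_mat w"
  have H: "?H \<in> carrier_mat n n" using w by (rule householder_mat_carrier)
  have "?H *\<^sub>v (?H *\<^sub>v x) = x" if x: "x \<in> carrier_vec n" for x
  proof -
    define c where "c = 2 * (w \<bullet> x) / (w \<bullet> w)"
    have Hx: "?H *\<^sub>v x = x - c \<cdot>\<^sub>v w"
      unfolding c_def by (rule householder_mat_mult_vec[OF w x])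
    have "2 * (w \<bullet> (x - c \<cdot>\<^sub>v w)) / (w \<bullet> w) = c - 2 * c * ((w \<bullet> w) / (w \<bullet> w))"
      using w x by (simp add: scalar_prod_minus_distrib[of w n] c_def diff_divide_distrib
          right_diff_distrib)
    also have "\<dots> = - c" by (simp add: c_def)
    finally have "?H *\<^sub>v (x - c \<cdot>\<^sub>v w) = (x - c \<cdot>\<^sub>v w) - (- c) \<cdot>\<^sub>v w"
      using householder_mat_mult_vec[OF w, of "x - c \<cdot>\<^sub>v w"] w x by simp
    also have "\<dots> = x" using w x by (intro eq_vecI) auto
    finally show ?thesis by (simp add: Hx)
  qed
  then have "col (?H * ?H) j = col (1\<^sub>m n) j" if "j < n" for j
    using that
    by (simp only: col_mult2[OF H H] mult_mat_unit_vec[OF H, symmetric] unit_vec_carrier col_one)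
  then show ?thesis using H by (intro mat_col_eqI) auto
qed

lemma householder_mat_diff_mult_vec:
  fixes u v :: "real vec"
  assumes u: "u \<in> carrier_vec n" and v: "v \<in> carrier_vec n" and same_norm: "u \<bullet> u = v \<bullet> v"
  shows "householder_mat (u - v) *\<^sub>v u = v"
proof -
  have w: "u - v \<in> carrier_vec n" using u v by simp
  have "(u - v) \<bullet> (u - v) = 2 * ((u - v) \<bullet> u)"
    using u v same_norm
    by (simp add: minus_scalar_prod_distrib[of _ n] scalar_prod_minus_distrib[of _ n]
        comm_scalar_prod[of u n v])
  moreover have "(u - v) \<bullet> (u - v) = 0 \<longleftrightarrow> u - v = 0\<^sub>v n"
    using conjugate_square_eq_0_vec[OF w] by simp
  ultimately have "(2 * ((u - v) \<bullet> u) / ((u - v) \<bullet> (u - v))) \<cdot>\<^sub>v (u - v) = u - v"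
    by (cases "u - v = 0\<^sub>v n") auto
  then show ?thesis
    using u v by (simp add: householder_mat_mult_vec[OF w u]) auto
qed

lemma eigenvector_reflection:
  fixes A :: "real mat"
  assumes A: "A \<in> carrier_mat (Suc n) (Suc n)" and "eigenvector A u e"
  obtains H where "H \<in> carrier_mat (Suc n) (Suc n)" "H\<^sup>T = H" "H * H = 1\<^sub>m (Suc n)"
    and "col (H * A * H) 0 = e \<cdot>\<^sub>v unit_vec (Suc n) 0"
proof
  have u: "u \<in> carrier_vec (Suc n)" "u \<noteq> 0\<^sub>v (Suc n)" and Au: "A *\<^sub>v u = e \<cdot>\<^sub>v u"
    using assms by (auto simp: eigenvector_def)
  define c where "c = sqrt (u \<bullet> u)"
  define v where "v = c \<cdot>\<^sub>v unit_vec (Suc n) 0"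
  define H where "H = householder_mat (u - v)"
  have "u \<bullet> u > 0" using conjugate_square_greater_0_vec[OF u(1)] u(2) by simp
  then have c: "c > 0" "c * c = u \<bullet> u" by (auto simp: c_def)
  have v: "v \<in> carrier_vec (Suc n)" by (simp add: v_def)
  show H: "H \<in> carrier_mat (Suc n) (Suc n)" and "H\<^sup>T = H" and HH: "H * H = 1\<^sub>m (Suc n)"
    unfolding H_def using u(1) v
    by (auto intro: householder_mat_carrier transpose_householder_mat householder_mat_involution)
  have Hu: "H *\<^sub>v u = v"
    unfolding H_def using u(1) v c by (intro householder_mat_diff_mult_vec) (auto simp: v_def)
  have "H *\<^sub>v v = (H * H) *\<^sub>v u" using H u(1) by (simp add: Hu)
  then have Hv: "H *\<^sub>v v = u" using HH u(1) by simp
  have HAH: "H * A * H \<in> carrier_mat (Suc n) (Suc n)" using H A by simp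
  have "c \<cdot>\<^sub>v col (H * A * H) 0 = (H * A * H) *\<^sub>v v"
    using HAH by (simp add: v_def mult_mat_vec mult_mat_unit_vec)
  also have "\<dots> = H *\<^sub>v (A *\<^sub>v u)"
    using H A v by (simp add: assoc_mult_mat_vec[of _ "Suc n" "Suc n" _ "Suc n"] Hv)
  also have "\<dots> = c \<cdot>\<^sub>v (e \<cdot>\<^sub>v unit_vec (Suc n) 0)"
    using H u(1) by (simp add: Au mult_mat_vec Hu) (simp add: v_def smult_smult_assoc mult.commute)
  finally have "(1 / c) \<cdot>\<^sub>v (c \<cdot>\<^sub>v col (H * A * H) 0)
      = (1 / c) \<cdot>\<^sub>v (c \<cdot>\<^sub>v (e \<cdot>\<^sub>v unit_vec (Suc n) 0))"
    by simp
  then show "col (H * A * H) 0 = e \<cdot>\<^sub>v unit_vec (Suc n) 0"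
    using c(1) by (simp add: smult_smult_assoc)
qed

definition scalar_block_mat :: "'a :: zero \<Rightarrow> 'a mat \<Rightarrow> 'a mat" where
  "scalar_block_mat e B =
     four_block_mat (mat 1 1 (\<lambda>_. e)) (0\<^sub>m 1 (dim_col B)) (0\<^sub>m (dim_row B) 1) B"

lemma scalar_block_mat_carrier:
  "B \<in> carrier_mat n n \<Longrightarrow> scalar_block_mat e B \<in> carrier_mat (Suc n) (Suc n)"
  by (auto simp: scalar_block_mat_def)

lemma transpose_scalar_block_mat: "(scalar_block_mat e B)\<^sup>T = scalar_block_mat e B\<^sup>T"
  by (intro eq_matI) (auto simp: scalar_block_mat_def)

lemma scalar_block_mat_diag: "scalar_block_mat e (mat_diag n l) = mat_diag (Suc n) (case_nat e l)"
  by (intro eq_matI) (auto simp: scalar_block_mat_def mat_diag_def split: nat.split)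

lemma similar_mat_wit_scalar_block_mat:
  fixes B :: "'a :: comm_ring_1 mat"
  assumes "similar_mat_wit B D P Q"
  shows "similar_mat_wit (scalar_block_mat e B) (scalar_block_mat e D)
    (scalar_block_mat 1 P) (scalar_block_mat 1 Q)"
proof -
  define n where "n = dim_row B"
  note carriers = similar_mat_witD(4-7)[OF n_def assms]
  have "mat 1 1 (\<lambda>_. 1 :: 'a) = 1\<^sub>m 1" by (intro eq_matI) auto
  moreover have "similar_mat_wit (mat 1 1 (\<lambda>_. e)) (mat 1 1 (\<lambda>_. e)) (1\<^sub>m 1) (1\<^sub>m 1)"
    by (rule similar_mat_wit_refl) simp
  ultimately show ?thesis
    using carriers unfolding scalar_block_mat_def
    by (auto intro!: similar_mat_wit_four_block[OF _ assms])
qed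

lemma symmetric_mat_eq_scalar_block_mat:
  fixes A :: "'a :: semiring_1 mat"
  assumes A: "A \<in> carrier_mat (Suc n) (Suc n)" and sym: "A\<^sup>T = A"
    and col: "col A 0 = e \<cdot>\<^sub>v unit_vec (Suc n) 0"
  obtains B where "B \<in> carrier_mat n n" "B\<^sup>T = B" "A = scalar_block_mat e B"
proof
  let ?B = "mat n n (\<lambda>(i, j). A $$ (Suc i, Suc j))"
  have transpose: "A $$ (i, j) = A $$ (j, i)" if "i < Suc n" "j < Suc n" for i j
    using arg_cong[OF sym, of "\<lambda>M. M $$ (i, j)"] that A by simp
  have first_col: "A $$ (i, 0) = (if i = 0 then e else 0)" if "i < Suc n" for i
    using arg_cong[OF col, of "\<lambda>x. x $ i"] that A by (auto simp: unit_vec_def)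
  then have first_row: "A $$ (0, i) = (if i = 0 then e else 0)" if "i < Suc n" for i
    using that transpose[of 0 i] by simp
  show "?B \<in> carrier_mat n n" by simp
  show "?B\<^sup>T = ?B" by (intro eq_matI) (auto intro: transpose)
  show "A = scalar_block_mat e ?B"
    unfolding scalar_block_mat_def using A first_col first_row by (intro eq_matI) auto
qed

lemma symmetric_mat_deflation:
  fixes A :: "real mat"
  assumes A: "A \<in> carrier_mat (Suc n) (Suc n)" and sym: "A\<^sup>T = A"
  obtains H e B where "H\<^sup>T = H" "B \<in> carrier_mat n n" "B\<^sup>T = B"
    and "similar_mat_wit A (scalar_block_mat e B) H H"
proof -
  obtain e where "eigenvalue A e" by (rule symmetric_mat_has_eigenvalue[OF A sym zero_less_Suc])
  then obtain u where "eigenvector A u e" by (auto simp: eigenvalue_def)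
  from eigenvector_reflection[OF A this] obtain H
    where H: "H \<in> carrier_mat (Suc n) (Suc n)" and sym_H: "H\<^sup>T = H" and HH: "H * H = 1\<^sub>m (Suc n)"
      and col: "col (H * A * H) 0 = e \<cdot>\<^sub>v unit_vec (Suc n) 0" .
  have HAH: "H * A * H \<in> carrier_mat (Suc n) (Suc n)" using H A by simp
  have sym_HAH: "(H * A * H)\<^sup>T = H * A * H"
    using H A by (simp add: transpose_mult[of _ "Suc n" "Suc n" _ "Suc n"] sym sym_H)
  obtain B where B: "B \<in> carrier_mat n n" "B\<^sup>T = B"
    and block: "H * A * H = scalar_block_mat e B"
    by (rule symmetric_mat_eq_scalar_block_mat[OF HAH sym_HAH col])
  have "similar_mat_wit (H * A * H) A H H"
    by (rule similar_mat_witI[OF HH HH refl HAH A H H])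
  then have "similar_mat_wit A (H * A * H) H H" by (rule similar_mat_wit_sym)
  with sym_H B show thesis unfolding block by (rule that)
qed

theorem symmetric_mat_orthogonally_diagonalizable:
  fixes A :: "real mat"
  assumes "A \<in> carrier_mat n n" "A\<^sup>T = A"
  shows "\<exists>P l. similar_mat_wit A (mat_diag n l) P P\<^sup>T"
  using assms
proof (induction n arbitrary: A)
  case 0
  then have "A = 1\<^sub>m 0" by (intro eq_matI) auto
  then have "similar_mat_wit A (mat_diag 0 (\<lambda>_. 1)) (1\<^sub>m 0) (1\<^sub>m 0)\<^sup>T"
    by (simp add: similar_mat_wit_refl)
  then show ?case by blast
next
  case (Suc n)
  obtain H e B where sym_H: "H\<^sup>T = H" and B: "B \<in> carrier_mat n n" "B\<^sup>T = B"
    and A_B: "similar_mat_wit A (scalar_block_mat e B) H H"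
    by (rule symmetric_mat_deflation[OF Suc.prems])
  obtain P l where B_diag: "similar_mat_wit B (mat_diag n l) P P\<^sup>T"
    using Suc.IH[OF B] by blast
  let ?Q = "scalar_block_mat 1 P"
  have "similar_mat_wit (scalar_block_mat e B) (mat_diag (Suc n) (case_nat e l)) ?Q ?Q\<^sup>T"
    using similar_mat_wit_scalar_block_mat[OF B_diag]
    by (simp only: scalar_block_mat_diag transpose_scalar_block_mat)
  with A_B have "similar_mat_wit A (mat_diag (Suc n) (case_nat e l)) (H * ?Q) (?Q\<^sup>T * H)"
    by (rule similar_mat_wit_trans)
  also have "?Q\<^sup>T * H = (H * ?Q)\<^sup>T"
    using transpose_mult[OF similar_mat_witD2(6)[OF Suc.prems(1) A_B]
        scalar_block_mat_carrier[OF similar_mat_witD2(6)[OF B(1) B_diag]]]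
    by (simp add: sym_H)
  finally show ?case by blast
qed

section \<open>Eigenvalues, traces and quadratic forms\<close>

definition mat_trace :: "'a :: comm_monoid_add mat \<Rightarrow> 'a" where
  "mat_trace A = sum_list (diag_mat A)"

lemma mat_trace_conv_sum: "A \<in> carrier_mat n n \<Longrightarrow> mat_trace A = (\<Sum>i<n. A $$ (i, i))"
  by (auto simp: mat_trace_def diag_mat_def sum_list_sum_nth atLeast0LessThan)

lemma mat_trace_mult_commute:
  fixes A :: "'a :: comm_semiring_0 mat"
  assumes A: "A \<in> carrier_mat m n" and B: "B \<in> carrier_mat n m"
  shows "mat_trace (A * B) = mat_trace (B * A)"
proof -
  have "mat_trace (A * B) = (\<Sum>i<m. \<Sum>j<n. A $$ (i, j) * B $$ (j, i))"
    using A B by (simp add: mat_trace_conv_sum[of _ m] scalar_prod_def atLeast0LessThan)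
  also have "\<dots> = (\<Sum>j<n. \<Sum>i<m. B $$ (j, i) * A $$ (i, j))"
    by (subst sum.swap) (simp add: mult.commute)
  also have "\<dots> = mat_trace (B * A)"
    using A B by (simp add: mat_trace_conv_sum[of _ n] scalar_prod_def atLeast0LessThan)
  finally show ?thesis .
qed

lemma mat_trace_similar:
  fixes A :: "'a :: comm_semiring_1 mat"
  assumes "similar_mat_wit A B P Q"
  shows "mat_trace A = mat_trace B"
proof -
  define n where "n = dim_row A"
  note wit = similar_mat_witD[OF n_def assms]
  have "mat_trace A = mat_trace (P * (B * Q))"
    using wit by simp
  also have "\<dots> = mat_trace (B * Q * P)"
    using wit by (intro mat_trace_mult_commute) auto
  also have "B * Q * P = B"
    using wit by simp
  finally show ?thesis .
qed

lemma mat_diag_pow: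
  fixes l :: "nat \<Rightarrow> 'a :: semiring_1"
  shows "mat_diag n l ^\<^sub>m k = mat_diag n (\<lambda>i. l i ^ k)"
  by (induction k) (simp_all add: carrier_matD[OF mat_diag_dim] power_commutes)

lemma proots_char_poly_mat_diag:
  fixes l :: "nat \<Rightarrow> 'a :: idom"
  shows "proots (char_poly (mat_diag n l)) = image_mset l (mset_set {..<n})"
proof -
  have "char_poly (mat_diag n l) = (\<Prod>x\<leftarrow>diag_mat (mat_diag n l). [:- x, 1:])"
    by (rule char_poly_upper_triangular[of _ n]) (auto simp: mat_diag_def)
  also have "diag_mat (mat_diag n l) = map l [0..<n]"
    by (auto simp: diag_mat_def mat_diag_def)
  also have "(\<Prod>x\<leftarrow>\<dots>. [:- x, 1:]) = (\<Prod>i<n. [:- l i, 1:])"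
    by (simp add: prod.distinct_set_conv_list[symmetric] comp_def atLeast0LessThan)
  finally have "proots (char_poly (mat_diag n l)) = (\<Sum>i<n. {#l i#})"
    by (simp add: proots_prod)
  then show ?thesis
    by (simp add: sum_unfold_sum_mset)
qed

lemma proots_char_poly_diagonalizable:
  fixes A :: "'a :: idom mat"
  assumes "similar_mat_wit A (mat_diag n l) P Q"
  shows "proots (char_poly A) = image_mset l (mset_set {..<n})"
proof -
  have "char_poly A = char_poly (mat_diag n l)"
    using assms by (intro char_poly_similar) (auto simp: similar_mat_def)
  then show ?thesis by (simp add: proots_char_poly_mat_diag)
qed

lemma sum_eigenvalue_powers_diagonalizable:
  fixes A :: "'a :: idom mat"
  assumes "similar_mat_wit A (mat_diag n l) P Q"
  shows "(\<Sum>x\<in>#proots (char_poly A). x ^ k) = mat_trace (A ^\<^sub>m k)"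
proof -
  have "(\<Sum>x\<in>#proots (char_poly A). x ^ k) = (\<Sum>i<n. l i ^ k)"
    by (simp add: proots_char_poly_diagonalizable[OF assms] image_mset.compositionality comp_def
        sum_unfold_sum_mset)
  also have "\<dots> = mat_trace (mat_diag n (\<lambda>i. l i ^ k))"
    by (simp add: mat_trace_conv_sum[OF mat_diag_dim]) (simp add: mat_diag_def)
  also have "\<dots> = mat_trace (A ^\<^sub>m k)"
    using mat_trace_similar[OF similar_mat_wit_pow[OF assms]] by (simp add: mat_diag_pow)
  finally show ?thesis .
qed

lemma proots_char_poly_iff_eigenvalue:
  fixes A :: "'a :: field mat"
  assumes A: "A \<in> carrier_mat n n"
  shows "e \<in># proots (char_poly A) \<longleftrightarrow> eigenvalue A e"
proof -
  have "char_poly A \<noteq> 0" using degree_monic_char_poly[OF A] by auto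
  then show ?thesis by (simp add: eigenvalue_root_char_poly[OF A])
qed

lemma eigenvalue_diagonalizable:
  fixes A :: "'a :: field mat"
  assumes "A \<in> carrier_mat n n" "similar_mat_wit A (mat_diag n l) P Q" "i < n"
  shows "eigenvalue A (l i)"
  using assms
  by (simp add: proots_char_poly_iff_eigenvalue[symmetric] proots_char_poly_diagonalizable)

lemma quadratic_form_le_orthogonally_diagonalizable:
  fixes A :: "real mat"
  assumes A: "A \<in> carrier_mat n n" and wit: "similar_mat_wit A (mat_diag n l) P P\<^sup>T"
    and le: "\<And>i. i < n \<Longrightarrow> l i \<le> r" and x: "x \<in> carrier_vec n"
  shows "x \<bullet> (A *\<^sub>v x) \<le> r * (x \<bullet> x)"
proof -
  define y where "y = P\<^sup>T *\<^sub>v x"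
  have P: "P \<in> carrier_mat n n" and PPt: "P * P\<^sup>T = 1\<^sub>m n" and A_eq: "A = P * mat_diag n l * P\<^sup>T"
    using similar_mat_witD2[OF A wit] by blast+
  have y: "y \<in> carrier_vec n" using P x by (simp add: y_def)
  have adjoint: "y \<bullet> z = x \<bullet> (P *\<^sub>v z)" if "z \<in> carrier_vec n" for z
    unfolding y_def using P that x by (rule transpose_vec_mult_scalar)
  have "A *\<^sub>v x = P *\<^sub>v (mat_diag n l *\<^sub>v y)"
    using P x unfolding A_eq y_def by (simp add: assoc_mult_mat_vec[of _ n n _ n])
  then have "x \<bullet> (A *\<^sub>v x) = y \<bullet> (mat_diag n l *\<^sub>v y)"
    using y by (simp add: adjoint mult_mat_vec_carrier[OF mat_diag_dim])
  also have "mat_diag n l *\<^sub>v y = vec n (\<lambda>i. l i * y $ i)"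
    using y by (intro eq_vecI)
      (auto simp: mat_diag_def scalar_prod_def if_distrib[of "\<lambda>a. a * _"] cong: if_cong)
  also have "y \<bullet> \<dots> \<le> r * (y \<bullet> y)"
    using le y by (auto simp: scalar_prod_def sum_distrib_left mult.left_commute
        intro!: sum_mono mult_right_mono)
  also have "y \<bullet> y = x \<bullet> ((P * P\<^sup>T) *\<^sub>v x)"
    unfolding adjoint[OF y] using P x by (simp add: y_def assoc_mult_mat_vec[of _ n n _ n])
  finally show ?thesis using x by (simp add: PPt)
qed

lemma symmetric_mat_quadratic_form_le:
  fixes A :: "real mat"
  assumes A: "A \<in> carrier_mat n n" and sym: "A\<^sup>T = A"
    and le: "\<And>e. eigenvalue A e \<Longrightarrow> e \<le> r" and x: "x \<in> carrier_vec n"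
  shows "x \<bullet> (A *\<^sub>v x) \<le> r * (x \<bullet> x)"
proof -
  obtain P l where wit: "similar_mat_wit A (mat_diag n l) P P\<^sup>T"
    using symmetric_mat_orthogonally_diagonalizable[OF A sym] by blast
  show ?thesis
    using A wit _ x
    by (rule quadratic_form_le_orthogonally_diagonalizable)
      (intro le eigenvalue_diagonalizable[OF A wit])
qed

lemma symmetric_mat_square_norm_le:
  fixes A :: "real mat"
  assumes A: "A \<in> carrier_mat n n" and sym: "A\<^sup>T = A"
    and le: "\<And>e. eigenvalue A e \<Longrightarrow> \<bar>e\<bar> \<le> r" and x: "x \<in> carrier_vec n"
  shows "(A *\<^sub>v x) \<bullet> (A *\<^sub>v x) \<le> r\<^sup>2 * (x \<bullet> x)"
proof -
  obtain P l where wit: "similar_mat_wit A (mat_diag n l) P P\<^sup>T"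
    using symmetric_mat_orthogonally_diagonalizable[OF A sym] by blast
  have "(l i)\<^sup>2 \<le> r\<^sup>2" if "i < n" for i
    using le[OF eigenvalue_diagonalizable[OF A wit that]] by (simp add: abs_le_square_iff[symmetric])
  moreover have "similar_mat_wit (A ^\<^sub>m 2) (mat_diag n (\<lambda>i. (l i)\<^sup>2)) P P\<^sup>T"
    using similar_mat_wit_pow[OF wit, of 2] by (simp add: mat_diag_pow)
  ultimately have "x \<bullet> (A ^\<^sub>m 2 *\<^sub>v x) \<le> r\<^sup>2 * (x \<bullet> x)"
    using A x by (intro quadratic_form_le_orthogonally_diagonalizable[of _ n]) auto
  moreover have "A ^\<^sub>m 2 *\<^sub>v x = A *\<^sub>v (A *\<^sub>v x)"
    using A x by (simp add: numeral_2_eq_2 assoc_mult_mat_vec[of _ n n _ n])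
  moreover have "(A *\<^sub>v x) \<bullet> (A *\<^sub>v x) = x \<bullet> (A *\<^sub>v (A *\<^sub>v x))"
    using transpose_vec_mult_scalar[OF A _ x, of "A *\<^sub>v x"] A x by (simp add: sym)
  ultimately show ?thesis by simp
qed

lemma nonneg_mat_abs_eigenvalue_le:
  fixes A :: "real mat"
  assumes A: "A \<in> carrier_mat n n" and nonneg: "\<And>i j. i < n \<Longrightarrow> j < n \<Longrightarrow> A $$ (i, j) \<ge> 0"
    and le: "\<And>x. x \<in> carrier_vec n \<Longrightarrow> x \<bullet> (A *\<^sub>v x) \<le> r * (x \<bullet> x)"
    and "eigenvalue A e"
  shows "\<bar>e\<bar> \<le> r"
proof -
  obtain v where v: "v \<in> carrier_vec n" "v \<noteq> 0\<^sub>v n" and Av: "A *\<^sub>v v = e \<cdot>\<^sub>v v"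
    using assms by (auto simp: eigenvalue_def eigenvector_def)
  have quadratic_form: "x \<bullet> (A *\<^sub>v x) = (\<Sum>i<n. \<Sum>j<n. x $ i * (A $$ (i, j) * x $ j))"
    if "x \<in> carrier_vec n" for x
    using A that by (simp add: scalar_prod_def sum_distrib_left atLeast0LessThan)
  define w where "w = map_vec abs v"
  have w: "w \<in> carrier_vec n" using v by (simp add: w_def)
  have ww: "w \<bullet> w = v \<bullet> v" using v by (simp add: w_def scalar_prod_def)
  have vv: "v \<bullet> v > 0" using conjugate_square_greater_0_vec[OF v(1)] v(2) by simp
  then have "\<bar>e\<bar> * (v \<bullet> v) = \<bar>v \<bullet> (A *\<^sub>v v)\<bar>"
    using v by (simp add: Av abs_mult)
  also have "\<dots> \<le> (\<Sum>i<n. \<Sum>j<n. \<bar>v $ i * (A $$ (i, j) * v $ j)\<bar>)"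
    unfolding quadratic_form[OF v(1)] by (rule order.trans[OF sum_abs sum_mono[OF sum_abs]])
  also have "\<dots> = w \<bullet> (A *\<^sub>v w)"
    unfolding quadratic_form[OF w] using v nonneg
    by (intro sum.cong refl) (auto simp: w_def abs_mult)
  also have "\<dots> \<le> r * (v \<bullet> v)"
    using le[OF w] by (simp add: ww)
  finally show ?thesis using vv by simp
qed

lemma sum_positive_squares_le:
  fixes M :: "real multiset"
  assumes "r > 0" and "\<And>x. x \<in># M \<Longrightarrow> \<bar>x\<bar> \<le> r"
  shows "(\<Sum>x\<in>#filter_mset (\<lambda>x. x > 0) M. x\<^sup>2) \<le> (\<Sum>x\<in>#M. x\<^sup>2) + (\<Sum>x\<in>#M. x ^ 3) / r"
  using assms(2)
proof (induction M)
  case (add x M)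
  have "(if x > 0 then x\<^sup>2 else 0) \<le> x\<^sup>2 + x ^ 3 / r"
  proof (cases "x > 0")
    case False
    have "x\<^sup>2 + x ^ 3 / r = x\<^sup>2 * (r + x) / r"
      using \<open>r > 0\<close> by (simp add: field_simps power2_eq_square power3_eq_cube)
    moreover have "r + x \<ge> 0" using add.prems[of x] by simp
    ultimately show ?thesis using False \<open>r > 0\<close> by simp
  qed (use \<open>r > 0\<close> in simp)
  moreover have "(\<Sum>x\<in>#filter_mset (\<lambda>x. x > 0) M. x\<^sup>2) \<le> (\<Sum>x\<in>#M. x\<^sup>2) + (\<Sum>x\<in>#M. x ^ 3) / r"
    using add by simp
  ultimately show ?case by (auto simp: add_divide_distrib split: if_splits)
qed simp

lemma sum_positive_squares_le_max:
  fixes M :: "real multiset"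
  assumes "r \<in># M" "r > 0" and "\<And>x. x \<in># M \<Longrightarrow> \<bar>x\<bar> \<le> r"
  shows "(\<Sum>x\<in>#filter_mset (\<lambda>x. x > 0) M. x\<^sup>2)
    \<le> (\<Sum>x\<in>#M. x\<^sup>2) - r\<^sup>2 + (\<Sum>x\<in>#M. x ^ 3) / r"
proof -
  obtain M' where M: "M = add_mset r M'" using \<open>r \<in># M\<close> by (blast dest: multi_member_split)
  have "r ^ 3 / r = r\<^sup>2" using \<open>r > 0\<close> by (simp add: power2_eq_square power3_eq_cube)
  moreover have "(\<Sum>x\<in>#filter_mset (\<lambda>x. x > 0) M'. x\<^sup>2) \<le> (\<Sum>x\<in>#M'. x\<^sup>2) + (\<Sum>x\<in>#M'. x ^ 3) / r"
    using assms by (intro sum_positive_squares_le) (auto simp: M)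
  ultimately show ?thesis using \<open>r > 0\<close> by (simp add: M add_divide_distrib)
qed

section \<open>Turan's theorem\<close>

lemma card_Int_Times:
  assumes "finite A" "finite B"
  shows "card (E \<inter> A \<times> B) = (\<Sum>u\<in>A. card (E `` {u} \<inter> B))"
proof -
  have "E \<inter> A \<times> B = (SIGMA u:A. E `` {u} \<inter> B)" by auto
  then show ?thesis using assms by simp
qed

lemma real_card_Int_Times:
  assumes "finite A" "finite B"
  shows "real (card (E \<inter> A \<times> B)) = (\<Sum>u\<in>A. \<Sum>v\<in>B. of_bool ((u, v) \<in> E))"
  using assms by (simp add: card_Int_Times Image_singleton Int_commute)

lemma card_Int_Times_commute:
  assumes "sym E"
  shows "card (E \<inter> A \<times> B) = card (E \<inter> B \<times> A)"
proof (rule bij_betw_same_card)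
  show "bij_betw prod.swap (E \<inter> A \<times> B) (E \<inter> B \<times> A)"
    using symD[OF assms] by (intro bij_betw_byWitness[of _ prod.swap]) auto
qed

definition card_cliques_le :: "'a rel \<Rightarrow> 'a set \<Rightarrow> nat \<Rightarrow> bool" where
  "card_cliques_le E V r \<longleftrightarrow> (\<forall>C\<subseteq>V. pairwise (\<lambda>x y. (x, y) \<in> E) C \<longrightarrow> card C \<le> r)"

lemma card_cliques_leD:
  "card_cliques_le E V r \<Longrightarrow> C \<subseteq> V \<Longrightarrow> pairwise (\<lambda>x y. (x, y) \<in> E) C \<Longrightarrow> card C \<le> r"
  by (simp add: card_cliques_le_def)

lemma card_cliques_le_neighbourhood:
  assumes "sym E" "irrefl E" "finite V" "v \<in> V" and cliques: "card_cliques_le E V r"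
  shows "card_cliques_le E (E `` {v} \<inter> V) (r - 1)"
  unfolding card_cliques_le_def
proof (intro allI impI)
  fix C assume C: "C \<subseteq> E `` {v} \<inter> V" "pairwise (\<lambda>x y. (x, y) \<in> E) C"
  have "finite C" "v \<notin> C"
    using C(1) \<open>finite V\<close> \<open>irrefl E\<close> by (auto simp: irrefl_def intro: finite_subset)
  moreover have "card (insert v C) \<le> r"
    using C \<open>v \<in> V\<close> \<open>sym E\<close>
    by (intro card_cliques_leD[OF cliques]) (auto simp: pairwise_insert dest: symD)
  ultimately show "card C \<le> r - 1" by simp
qed

lemma card_cliques_le_imp_ge_2:
  assumes "sym E" "irrefl E" and cliques: "card_cliques_le E V r" and "E \<inter> V \<times> V \<noteq> {}"
  shows "r \<ge> 2"
proof -
  obtain x y where xy: "(x, y) \<in> E" "x \<in> V" "y \<in> V" using assms(4) by auto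
  have "x \<noteq> y" using xy(1) \<open>irrefl E\<close> by (auto simp: irrefl_def)
  moreover have "card {x, y} \<le> r"
    using xy \<open>sym E\<close>
    by (intro card_cliques_leD[OF cliques]) (auto simp: pairwise_insert dest: symD)
  ultimately show ?thesis by simp
qed

lemma card_arcs_le_max_degree:
  assumes "sym E" "finite V" "v \<in> V"
    and max: "\<And>u. u \<in> V \<Longrightarrow> card (E `` {u} \<inter> V) \<le> card (E `` {v} \<inter> V)"
  defines "N \<equiv> E `` {v} \<inter> V"
  shows "real (card (E \<inter> V \<times> V))
    \<le> real (card (E \<inter> N \<times> N)) + 2 * ((real (card V) - real (card N)) * real (card N))"
proof -
  have N: "finite N" "N \<subseteq> V" using \<open>finite V\<close> by (auto simp: N_def)
  have "card (E \<inter> (V - N) \<times> V) = (\<Sum>u\<in>V - N. card (E `` {u} \<inter> V))"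
    using \<open>finite V\<close> by (intro card_Int_Times) auto
  also have "\<dots> \<le> (\<Sum>u\<in>V - N. card N)"
    unfolding N_def by (intro sum_mono max) auto
  also have "\<dots> = (card V - card N) * card N"
    using N by (simp add: card_Diff_subset)
  finally have outside: "card (E \<inter> (V - N) \<times> V) \<le> (card V - card N) * card N" .
  have "card (E \<inter> V \<times> V) \<le> card (E \<inter> N \<times> N \<union> (E \<inter> (V - N) \<times> V \<union> E \<inter> V \<times> (V - N)))"
    using N \<open>finite V\<close> by (intro card_mono) auto
  also have "\<dots> \<le> card (E \<inter> N \<times> N) + (card (E \<inter> (V - N) \<times> V) + card (E \<inter> V \<times> (V - N)))"
    by (intro order.trans[OF card_Un_le] add_left_mono card_Un_le)
  also have "card (E \<inter> V \<times> (V - N)) = card (E \<inter> (V - N) \<times> V)"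
    using \<open>sym E\<close> by (rule card_Int_Times_commute)
  finally have "card (E \<inter> V \<times> V) \<le> card (E \<inter> N \<times> N) + 2 * ((card V - card N) * card N)"
    using outside by simp
  then have "real (card (E \<inter> V \<times> V))
      \<le> real (card (E \<inter> N \<times> N) + 2 * ((card V - card N) * card N))"
    by (simp only: of_nat_le_iff)
  then show ?thesis
    using N \<open>finite V\<close> by (simp add: card_mono)
qed

lemma turan_recursion:
  fixes k d n :: real
  assumes "k > 0"
  shows "(1 - 1 / k) * d\<^sup>2 + 2 * ((n - d) * d) \<le> (1 - 1 / (k + 1)) * n\<^sup>2"
proof -
  have "(1 - 1 / (k + 1)) * n\<^sup>2 - ((1 - 1 / k) * d\<^sup>2 + 2 * ((n - d) * d))
      = ((k + 1) * d - k * n)\<^sup>2 / (k * (k + 1))"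
    using assms by (simp add: field_simps) (simp add: power2_eq_square algebra_simps)
  also have "\<dots> \<ge> 0" using assms by simp
  finally show ?thesis by simp
qed

theorem turan_card_arcs_le:
  assumes "sym E" "irrefl E" "finite V" "card_cliques_le E V r"
  shows "real (card (E \<inter> V \<times> V)) \<le> (1 - 1 / r) * (real (card V))\<^sup>2"
  using assms(3,4)
proof (induction r arbitrary: V)
  case 0
  have "V = {}"
    using card_cliques_leD[OF "0.prems"(2), of "{v}" for v] by auto
  then show ?case by simp
next
  case (Suc r)
  note fin = \<open>finite V\<close>
  show ?case
  proof (cases "E \<inter> V \<times> V = {}")
    case False
    have "r > 0"
      using card_cliques_le_imp_ge_2[OF assms(1,2) Suc.prems(2) False] by simp
    let ?d = "\<lambda>u. card (E `` {u} \<inter> V)"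
    have "Max (?d ` V) \<in> ?d ` V"
      using fin False by (intro Max_in) auto
    then obtain v where v: "v \<in> V" and "?d v = Max (?d ` V)" by auto
    then have max: "?d u \<le> ?d v" if "u \<in> V" for u
      using fin that by simp
    define N where "N = E `` {v} \<inter> V"
    have "finite N" using fin by (simp add: N_def)
    have "card_cliques_le E N r"
      using card_cliques_le_neighbourhood[OF assms(1,2) fin v Suc.prems(2)] by (simp add: N_def)
    then have IH: "real (card (E \<inter> N \<times> N)) \<le> (1 - 1 / r) * (real (card N))\<^sup>2"
      by (rule Suc.IH[OF \<open>finite N\<close>])
    have "real (card (E \<inter> V \<times> V))
        \<le> real (card (E \<inter> N \<times> N)) + 2 * ((real (card V) - real (card N)) * real (card N))"
      unfolding N_def using assms(1) fin v max by (rule card_arcs_le_max_degree)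
    also have "\<dots> \<le> (1 - 1 / r) * (real (card N))\<^sup>2
        + 2 * ((real (card V) - real (card N)) * real (card N))"
      using IH by simp
    also have "\<dots> \<le> (1 - 1 / real (Suc r)) * (real (card V))\<^sup>2"
      using turan_recursion[of "real r" "real (card N)" "real (card V)"] \<open>r > 0\<close>
      by (simp add: add.commute)
    finally show ?thesis .
  qed simp
qed

definition ordered_triangles :: "'a rel \<Rightarrow> ('a \<times> 'a \<times> 'a) set" where
  "ordered_triangles E = {(u, v, w). (u, v) \<in> E \<and> (v, w) \<in> E \<and> (w, u) \<in> E}"

lemma card_ordered_triangles:
  assumes "sym E" "finite V" "E \<subseteq> V \<times> V"
  shows "card (ordered_triangles E) = (\<Sum>u\<in>V. card (E \<inter> (E `` {u}) \<times> (E `` {u})))"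
proof -
  have "finite E" using assms(2,3) by (auto intro: finite_subset)
  moreover have "ordered_triangles E = (SIGMA u:V. E \<inter> (E `` {u}) \<times> (E `` {u}))"
    using assms(1,3) by (auto simp: ordered_triangles_def dest: symD)
  ultimately show ?thesis using \<open>finite V\<close> by simp
qed

corollary card_ordered_triangles_le:
  assumes "sym E" "irrefl E" "finite V" "E \<subseteq> V \<times> V" "card_cliques_le E V r"
  shows "real (card (ordered_triangles E))
    \<le> (1 - 1 / real (r - 1)) * (\<Sum>v\<in>V. (real (card (E `` {v})))\<^sup>2)"
proof -
  have "real (card (E \<inter> (E `` {v}) \<times> (E `` {v})))
      \<le> (1 - 1 / real (r - 1)) * (real (card (E `` {v})))\<^sup>2"
    if "v \<in> V" for v
  proof (rule turan_card_arcs_le)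
    have N: "E `` {v} \<inter> V = E `` {v}" using assms(4) by auto
    show "card_cliques_le E (E `` {v}) (r - 1)"
      using card_cliques_le_neighbourhood[OF assms(1-3) that assms(5)] by (simp only: N)
    show "finite (E `` {v})" using assms(3) N by (metis finite_Int)
  qed (fact assms)+
  then show ?thesis
    unfolding card_ordered_triangles[OF assms(1,3,4)] of_nat_sum sum_distrib_left
    by (rule sum_mono)
qed

section \<open>Adjacency eigenvalues of a graph\<close>

lemma adjacency_matrix_carrier: "adjacency_matrix G vs \<in> carrier_mat (length vs) (length vs)"
  by (simp add: adjacency_matrix_def)

lemma adjacency_matrix_index:
  "i < length vs \<Longrightarrow> j < length vs \<Longrightarrow>
    adjacency_matrix G vs $$ (i, j) = of_bool ((vs ! i, vs ! j) \<in> parcs G)"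
  by (simp add: adjacency_matrix_def)

lemma adjacency_eigenvalues_iff:
  assumes "distinct vs" "set vs = pverts G"
  shows "e \<in># adjacency_eigenvalues G \<longleftrightarrow> eigenvalue (adjacency_matrix G vs) e"
  unfolding adjacency_eigenvalues_eq[OF assms]
  by (rule proots_char_poly_iff_eigenvalue[OF adjacency_matrix_carrier])

definition largest_adjacency_eigenvalue :: "'a pair_pre_digraph \<Rightarrow> real" where
  "largest_adjacency_eigenvalue G = Max (set_mset (adjacency_eigenvalues G))"

context pair_graph
begin

lemma parcs_commute: "(u, v) \<in> parcs G \<longleftrightarrow> (v, u) \<in> parcs G"
  using arcs_symmetric by blast

lemma sym_parcs: "sym (parcs G)"
  by (simp add: sym_def parcs_commute)

lemma irrefl_parcs: "irrefl (parcs G)"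
  by (auto simp: irrefl_def dest: no_loops')

lemma parcs_subset: "parcs G \<subseteq> pverts G \<times> pverts G"
  by (auto dest: wellformed')

lemma neighbours_subset: "parcs G `` {u} \<subseteq> pverts G"
  using parcs_subset by blast

lemma transpose_adjacency_matrix: "(adjacency_matrix G vs)\<^sup>T = adjacency_matrix G vs"
  by (intro eq_matI) (simp_all add: adjacency_matrix_def parcs_commute)

lemma vertex_enumeration:
  obtains vs where "distinct vs" "set vs = pverts G"
  using finite_distinct_list[OF pair_finite_verts] by blast

lemma adjacency_eigenvalues_nonempty:
  assumes "pverts G \<noteq> {}"
  shows "adjacency_eigenvalues G \<noteq> {#}"
proof -
  obtain vs where vs: "distinct vs" "set vs = pverts G" by (rule vertex_enumeration)
  then have "length vs > 0" using assms by auto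
  then obtain e where "eigenvalue (adjacency_matrix G vs) e"
    by (rule symmetric_mat_has_eigenvalue[OF adjacency_matrix_carrier transpose_adjacency_matrix])
  then show ?thesis
    using adjacency_eigenvalues_iff[OF vs] by auto
qed

lemma abs_adjacency_eigenvalue_le:
  assumes "e \<in># adjacency_eigenvalues G"
  shows "\<bar>e\<bar> \<le> largest_adjacency_eigenvalue G"
proof -
  let ?\<rho> = "largest_adjacency_eigenvalue G"
  obtain vs where vs: "distinct vs" "set vs = pverts G" by (rule vertex_enumeration)
  let ?A = "adjacency_matrix G vs"
  note eigenvalues = adjacency_eigenvalues_iff[OF vs]
  have le_max: "x \<le> ?\<rho>" if "eigenvalue ?A x" for x
    using that by (simp add: largest_adjacency_eigenvalue_def eigenvalues)
  show ?thesis
  proof (rule nonneg_mat_abs_eigenvalue_le[OF adjacency_matrix_carrier])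
    show "?A $$ (i, j) \<ge> 0" if "i < length vs" "j < length vs" for i j
      using that by (simp add: adjacency_matrix_index)
    show "x \<bullet> (?A *\<^sub>v x) \<le> ?\<rho> * (x \<bullet> x)" if "x \<in> carrier_vec (length vs)" for x
      using adjacency_matrix_carrier transpose_adjacency_matrix le_max that
      by (rule symmetric_mat_quadratic_form_le)
    show "eigenvalue ?A e" using assms by (simp add: eigenvalues)
  qed
qed

context
  fixes vs
  assumes distinct_vs: "distinct vs" and set_vs: "set vs = pverts G"
begin

lemma sum_pverts_conv_nth: "sum f (pverts G) = (\<Sum>i<length vs. f (vs ! i))"
  using bij_betw_nth[OF distinct_vs refl set_vs[symmetric]] by (rule sum.reindex_bij_betw[symmetric])

lemma sum_adjacency_eigenvalue_powers:
  "(\<Sum>x\<in>#adjacency_eigenvalues G. x ^ k) = mat_trace (adjacency_matrix G vs ^\<^sub>m k)"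
proof -
  obtain P l where "similar_mat_wit (adjacency_matrix G vs) (mat_diag (length vs) l) P P\<^sup>T"
    using symmetric_mat_orthogonally_diagonalizable[OF adjacency_matrix_carrier
        transpose_adjacency_matrix]
    by blast
  then show ?thesis
    unfolding adjacency_eigenvalues_eq[OF distinct_vs set_vs]
    by (rule sum_eigenvalue_powers_diagonalizable)
qed

lemma mat_trace_adjacency_matrix_square:
  "mat_trace (adjacency_matrix G vs ^\<^sub>m 2) = real (card (parcs G))"
proof -
  have "mat_trace (adjacency_matrix G vs ^\<^sub>m 2)
      = (\<Sum>i<length vs. \<Sum>j<length vs. of_bool ((vs ! i, vs ! j) \<in> parcs G))"
    using adjacency_matrix_carrier[of G vs]
    by (simp add: mat_trace_conv_sum[of _ "length vs"] numeral_2_eq_2 scalar_prod_def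
        atLeast0LessThan adjacency_matrix_index parcs_commute of_bool_conj[symmetric])
  also have "\<dots> = real (card (parcs G \<inter> pverts G \<times> pverts G))"
    by (simp only: real_card_Int_Times pair_finite_verts sum_pverts_conv_nth)
  also have "parcs G \<inter> pverts G \<times> pverts G = parcs G"
    using parcs_subset by (rule Int_absorb2)
  finally show ?thesis .
qed

lemma mat_trace_adjacency_matrix_cube:
  "mat_trace (adjacency_matrix G vs ^\<^sub>m 3) = real (card (ordered_triangles (parcs G)))"
proof -
  let ?N = "\<lambda>u. parcs G `` {u}"
  have "mat_trace (adjacency_matrix G vs ^\<^sub>m 3)
      = (\<Sum>i<length vs. \<Sum>j<length vs. \<Sum>k<length vs.
          of_bool ((vs ! j, vs ! k) \<in> parcs G \<inter> ?N (vs ! i) \<times> ?N (vs ! i)))"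
    using adjacency_matrix_carrier[of G vs]
    by (simp add: mat_trace_conv_sum[of _ "length vs"] numeral_3_eq_3 scalar_prod_def
        atLeast0LessThan adjacency_matrix_index sum_distrib_left sum_distrib_right parcs_commute
        conj_commute conj_left_commute of_bool_conj[symmetric]
        del: sum_of_bool_eq sum_mult_of_bool_eq sum_of_bool_mult_eq)
  also have "\<dots> = (\<Sum>u\<in>pverts G.
      real (card (parcs G \<inter> ?N u \<times> ?N u \<inter> pverts G \<times> pverts G)))"
    by (simp only: real_card_Int_Times pair_finite_verts sum_pverts_conv_nth)
  also have "\<dots> = (\<Sum>u\<in>pverts G. real (card (parcs G \<inter> ?N u \<times> ?N u)))"
    using parcs_subset by (intro sum.cong refl) (metis Int_absorb2 inf.coboundedI1)
  also have "\<dots> = real (card (ordered_triangles (parcs G)))"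
    by (simp add: card_ordered_triangles[OF sym_parcs pair_finite_verts parcs_subset])
  finally show ?thesis .
qed

lemma adjacency_matrix_mult_ones:
  "adjacency_matrix G vs *\<^sub>v vec (length vs) (\<lambda>_. 1)
    = vec (length vs) (\<lambda>i. real (card (parcs G `` {vs ! i})))" (is "?A *\<^sub>v ?one = ?degrees")
proof (rule eq_vecI)
  fix i assume "i < dim_vec ?degrees"
  then have i: "i < length vs" by simp
  have "(?A *\<^sub>v ?one) $ i = (\<Sum>v\<in>pverts G. of_bool ((vs ! i, v) \<in> parcs G))"
    unfolding sum_pverts_conv_nth using i adjacency_matrix_carrier[of G vs]
    by (simp add: scalar_prod_def atLeast0LessThan adjacency_matrix_index)
  also have "\<dots> = real (card (pverts G \<inter> parcs G `` {vs ! i}))"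
    by (simp add: Image_singleton)
  also have "pverts G \<inter> parcs G `` {vs ! i} = parcs G `` {vs ! i}"
    using neighbours_subset by (rule Int_absorb1)
  finally show "(?A *\<^sub>v ?one) $ i = ?degrees $ i"
    using i by simp
qed (simp add: adjacency_matrix_def)

end

lemma sum_adjacency_eigenvalues_square:
  "(\<Sum>x\<in>#adjacency_eigenvalues G. x\<^sup>2) = real (card (parcs G))"
  by (rule vertex_enumeration)
    (simp add: sum_adjacency_eigenvalue_powers mat_trace_adjacency_matrix_square)

lemma sum_adjacency_eigenvalues_cube:
  "(\<Sum>x\<in>#adjacency_eigenvalues G. x ^ 3) = real (card (ordered_triangles (parcs G)))"
  by (rule vertex_enumeration)
    (simp add: sum_adjacency_eigenvalue_powers mat_trace_adjacency_matrix_cube)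

lemma card_parcs_le_largest_eigenvalue:
  "real (card (parcs G)) \<le> largest_adjacency_eigenvalue G * real (card (pverts G))"
proof -
  obtain vs where vs: "distinct vs" "set vs = pverts G" by (rule vertex_enumeration)
  let ?A = "adjacency_matrix G vs" and ?one = "vec (length vs) (\<lambda>_. 1 :: real)"
  have "card (parcs G \<inter> pverts G \<times> pverts G) = (\<Sum>u\<in>pverts G. card (parcs G `` {u}))"
    using neighbours_subset by (simp add: card_Int_Times Int_absorb2)
  then have "real (card (parcs G)) = (\<Sum>u\<in>pverts G. real (card (parcs G `` {u})))"
    using parcs_subset by (simp add: Int_absorb2)
  also have "\<dots> = ?one \<bullet> (?A *\<^sub>v ?one)"
    by (simp add: adjacency_matrix_mult_ones[OF vs] sum_pverts_conv_nth[OF vs] scalar_prod_def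
        atLeast0LessThan)
  also have "\<dots> \<le> largest_adjacency_eigenvalue G * (?one \<bullet> ?one)"
    using abs_adjacency_eigenvalue_le
    by (intro symmetric_mat_quadratic_form_le[OF adjacency_matrix_carrier transpose_adjacency_matrix])
      (auto simp: adjacency_eigenvalues_iff[OF vs] abs_le_iff)
  also have "?one \<bullet> ?one = real (card (pverts G))"
    using distinct_card[OF vs(1)] by (simp add: scalar_prod_def vs(2))
  finally show ?thesis .
qed

lemma sum_degree_square_le_largest_eigenvalue:
  "(\<Sum>u\<in>pverts G. (real (card (parcs G `` {u})))\<^sup>2)
    \<le> (largest_adjacency_eigenvalue G)\<^sup>2 * real (card (pverts G))"
proof -
  obtain vs where vs: "distinct vs" "set vs = pverts G" by (rule vertex_enumeration)
  let ?A = "adjacency_matrix G vs" and ?one = "vec (length vs) (\<lambda>_. 1 :: real)"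
  have "(\<Sum>u\<in>pverts G. (real (card (parcs G `` {u})))\<^sup>2) = (?A *\<^sub>v ?one) \<bullet> (?A *\<^sub>v ?one)"
    by (simp add: adjacency_matrix_mult_ones[OF vs] sum_pverts_conv_nth[OF vs] scalar_prod_def
        atLeast0LessThan power2_eq_square)
  also have "\<dots> \<le> (largest_adjacency_eigenvalue G)\<^sup>2 * (?one \<bullet> ?one)"
    using abs_adjacency_eigenvalue_le
    by (intro symmetric_mat_square_norm_le[OF adjacency_matrix_carrier transpose_adjacency_matrix])
      (auto simp: adjacency_eigenvalues_iff[OF vs])
  also have "?one \<bullet> ?one = real (card (pverts G))"
    using distinct_card[OF vs(1)] by (simp add: scalar_prod_def vs(2))
  finally show ?thesis .
qed

lemma largest_adjacency_eigenvalue_pos: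
  assumes "parcs G \<noteq> {}"
  shows "largest_adjacency_eigenvalue G > 0"
proof -
  have "card (parcs G) > 0" using assms pair_finite_arcs by (simp add: card_gt_0_iff)
  then have "0 < largest_adjacency_eigenvalue G * real (card (pverts G))"
    using card_parcs_le_largest_eigenvalue by linarith
  then show ?thesis by (simp add: zero_less_mult_iff)
qed

lemma positive_square_energy_le:
  assumes "parcs G \<noteq> {}"
  shows "positive_square_energy G \<le> real (card (parcs G)) - (largest_adjacency_eigenvalue G)\<^sup>2
    + real (card (ordered_triangles (parcs G))) / largest_adjacency_eigenvalue G"
  unfolding positive_square_energy_def sum_adjacency_eigenvalues_square[symmetric]
    sum_adjacency_eigenvalues_cube[symmetric]
proof (rule sum_positive_squares_le_max)
  have "pverts G \<noteq> {}" using assms parcs_subset by auto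
  then show "largest_adjacency_eigenvalue G \<in># adjacency_eigenvalues G"
    unfolding largest_adjacency_eigenvalue_def
    using adjacency_eigenvalues_nonempty by (intro Max_in) auto
  show "largest_adjacency_eigenvalue G > 0"
    using assms by (rule largest_adjacency_eigenvalue_pos)
qed (rule abs_adjacency_eigenvalue_le)

lemma card_cliques_le_clique_number:
  "card_cliques_le (parcs G) (pverts G) (clique_number G)"
  unfolding card_cliques_le_def
proof (intro allI impI)
  fix C assume "C \<subseteq> pverts G" "pairwise (\<lambda>x y. (x, y) \<in> parcs G) C"
  then have "is_clique G C" by (auto simp: is_clique_def pairwise_def)
  moreover have "finite {C. is_clique G C}"
    by (rule finite_subset[of _ "Pow (pverts G)"]) (auto simp: is_clique_def)
  ultimately show "card C \<le> clique_number G"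
    unfolding clique_number_def by (intro Max_ge) auto
qed

lemma connected_imp_parcs_nonempty:
  assumes "connected (with_proj G)" "card (pverts G) \<ge> 2"
  shows "parcs G \<noteq> {}"
proof
  assume "parcs G = {}"
  obtain u v where "u \<in> pverts G" "v \<in> pverts G" "u \<noteq> v"
    using assms(2) card_le_Suc0_iff_eq[OF pair_finite_verts] by fastforce
  then have "u \<rightarrow>\<^sup>*\<^bsub>with_proj G\<^esub> v"
    using symmetric_connected_imp_strongly_connected[OF pair_sym_arcs assms(1)] by auto
  then have "(u, v) \<in> (parcs G)\<^sup>*"
    by (auto dest: reachable_rtranclI)
  with \<open>parcs G = {}\<close> \<open>u \<noteq> v\<close> show False by simp
qed

lemma card_ordered_triangles_le_largest_eigenvalue:
  "real (card (ordered_triangles (parcs G)))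
    \<le> (1 - 1 / real (clique_number G - 1))
      * ((largest_adjacency_eigenvalue G)\<^sup>2 * real (card (pverts G)))"
proof -
  have "real (card (ordered_triangles (parcs G)))
      \<le> (1 - 1 / real (clique_number G - 1)) * (\<Sum>v\<in>pverts G. (real (card (parcs G `` {v})))\<^sup>2)"
    using sym_parcs irrefl_parcs pair_finite_verts parcs_subset card_cliques_le_clique_number
    by (rule card_ordered_triangles_le)
  also have "\<dots> \<le> (1 - 1 / real (clique_number G - 1))
      * ((largest_adjacency_eigenvalue G)\<^sup>2 * real (card (pverts G)))"
    by (intro mult_left_mono sum_degree_square_le_largest_eigenvalue)
      (cases "clique_number G - 1", auto)
  finally show ?thesis .
qed

lemma card_parcs_le_clique_number:
  "real (card (parcs G)) \<le> (1 - 1 / real (clique_number G)) * (real (card (pverts G)))\<^sup>2"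
  using turan_card_arcs_le[OF sym_parcs irrefl_parcs pair_finite_verts card_cliques_le_clique_number]
  by (simp only: Int_absorb2[OF parcs_subset])

lemma clique_number_ge_2: "parcs G \<noteq> {} \<Longrightarrow> clique_number G \<ge> 2"
  using card_cliques_le_imp_ge_2[OF sym_parcs irrefl_parcs card_cliques_le_clique_number]
  by (simp add: Int_absorb2[OF parcs_subset])

end

section \<open>The clique bound\<close>

text \<open>As a function of \<open>r\<close>, the left-hand side is maximal where \<open>r n\<close> and \<open>t n\<close> cross.\<close>

lemma min_minus_square_le_crossing:
  fixes n t c r :: real
  assumes "c \<le> 2 * t" "2 * t \<le> c + n"
  shows "min (r * n) (t * n) - r\<^sup>2 + c * r \<le> t * n - t\<^sup>2 + c * t"
proof (cases "r \<le> t")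
  case True
  then have "(t - r) * (c + n - t - r) \<ge> 0" using assms(2) by (intro mult_nonneg_nonneg) auto
  then have "r * n - r\<^sup>2 + c * r \<le> t * n - t\<^sup>2 + c * t"
    by (simp add: power2_eq_square algebra_simps)
  then show ?thesis by linarith
next
  case False
  then have "(r - t) * (r + t - c) \<ge> 0" using assms(1) by (intro mult_nonneg_nonneg) auto
  then have "- (r\<^sup>2) + c * r \<le> - (t\<^sup>2) + c * t"
    by (simp add: power2_eq_square algebra_simps)
  then show ?thesis by linarith
qed

lemma index_bound_le_clique_bound:
  fixes n w r e :: real
  assumes w: "w \<ge> 2" and n: "n \<ge> 0" and "e \<le> r * n" "e \<le> (1 - 1 / w) * n\<^sup>2"
  shows "e - r\<^sup>2 + (1 - 1 / (w - 1)) * (r * n) \<le> n\<^sup>2 * (1 - 1 / w - 1 / w\<^sup>2)"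
proof -
  define a b where "a = 1 / (w - 1)" and "b = 1 / w"
  define c t where "c = (1 - a) * n" and "t = (1 - b) * n"
  have "a \<ge> 0" "b \<le> 1 / 2" "a \<le> 2 * b"
    using w by (simp_all add: a_def b_def field_simps)
  then have "(1 + a - 2 * b) * n \<ge> 0" "(2 * b - a) * n \<ge> 0"
    using n by auto
  then have "c \<le> 2 * t" "2 * t \<le> c + n"
    unfolding c_def t_def by (simp_all add: algebra_simps)
  moreover have "e \<le> t * n"
    using assms(4) by (simp add: t_def b_def power2_eq_square mult.assoc)
  ultimately have "e - r\<^sup>2 + c * r \<le> t * n - t\<^sup>2 + c * t"
    using min_minus_square_le_crossing[of c t n r] \<open>e \<le> r * n\<close> by linarith
  also have "t * n - t\<^sup>2 + c * t = n\<^sup>2 * ((1 - b) * (1 - a + b))"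
    by (simp add: c_def t_def power2_eq_square algebra_simps)
  also have "(1 - b) * (1 - a + b) = 1 - 1 / w - 1 / w\<^sup>2"
    using w by (simp add: a_def b_def field_simps power2_eq_square)
  finally show ?thesis by (simp add: c_def a_def mult_ac)
qed

theorem theorem1p10:
  fixes G :: "'a pair_pre_digraph" and n \<omega> :: nat
  assumes "pair_graph G"
    and "Digraph_Component.connected (with_proj G)"
    and "n = card (pverts G)"
    and "\<omega> = clique_number G"
    and "n \<ge> 2"
  shows "sqrt (positive_square_energy G) \<le> real n * sqrt (1 - 1 / real \<omega> - 1 / (real \<omega>)\<^sup>2)"
proof -
  interpret pair_graph G by fact
  let ?\<rho> = "largest_adjacency_eigenvalue G" and ?m = "real (card (parcs G))"
    and ?t = "real (card (ordered_triangles (parcs G)))"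
  have nonempty: "parcs G \<noteq> {}"
    using connected_imp_parcs_nonempty assms by simp
  then have "\<omega> \<ge> 2" and "?\<rho> > 0"
    using clique_number_ge_2 largest_adjacency_eigenvalue_pos \<open>\<omega> = _\<close> by auto
  then have "?t \<le> (1 - 1 / (real \<omega> - 1)) * (?\<rho>\<^sup>2 * n)"
    using card_ordered_triangles_le_largest_eigenvalue \<open>\<omega> = _\<close> \<open>n = _\<close> by simp
  then have "?t / ?\<rho> \<le> (1 - 1 / (real \<omega> - 1)) * (?\<rho> * n)"
    using \<open>?\<rho> > 0\<close> by (simp add: pos_divide_le_eq power2_eq_square mult_ac)
  then have "positive_square_energy G \<le> ?m - ?\<rho>\<^sup>2 + (1 - 1 / (real \<omega> - 1)) * (?\<rho> * n)"
    using positive_square_energy_le[OF nonempty] by linarith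
  also have "\<dots> \<le> (real n)\<^sup>2 * (1 - 1 / real \<omega> - 1 / (real \<omega>)\<^sup>2)"
    using \<open>\<omega> \<ge> 2\<close> card_parcs_le_largest_eigenvalue card_parcs_le_clique_number \<open>\<omega> = _\<close> \<open>n = _\<close>
    by (intro index_bound_le_clique_bound) auto
  finally have "sqrt (positive_square_energy G)
      \<le> sqrt ((real n)\<^sup>2 * (1 - 1 / real \<omega> - 1 / (real \<omega>)\<^sup>2))"
    by (rule real_sqrt_le_mono)
  then show ?thesis by (simp add: real_sqrt_mult)
qed

end
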